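(* Let $a$ and $n$ be positive integers. Among all triangle-free graphs $G$ with $n$ vertices, the Turán graph $K_{\lfloor n/2\rfloor,\lceil n/2\rceil}$ maximizes $n(S_{a,a},G)$; that is, $n(S_{a,a},G)\le n(S_{a,a},K_{\lfloor n/2\rfloor,\lceil n/2\rceil})$ for every triangle-free graph $G$ with $n$ vertices.
   Context: Graphs are finite and simple. For graphs $H$ and $G$, $n(H,G)$ denotes the number of (not necessarily induced) subgraphs of $G$ isomorphic to $H$. The star of degree $a$ is $K_{1,a}$, whose central vertex is the vertex of the part of size $1$. The double star $S_{a,b}$ is the graph formed from disjoint stars $K_{1,a}$ and $K_{1,b}$ by joining their central vertices by an edge. $K_{p,q}$ is the complete bipartite graph with parts of sizes $p$ and $q$. *)

theory Defs
  imports "Graph_Theory.Graph_Theory"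
begin

text \<open>
  A finite simple graph is a \<^locale>\<open>pair_graph\<close>: a finite, symmetric, loop-free digraph whose arcs are
  pairs of vertices. An undirected edge \<open>uv\<close> is the pair of arcs \<open>(u,v)\<close>, \<open>(v,u)\<close>.
\<close>

text \<open>
  The number \<open>n(H,G)\<close> of (not necessarily induced) subgraphs of \<open>G\<close> isomorphic to \<open>H\<close>.
  The library's \<^const>\<open>subgraph\<close> relation also admits digraphs that are not symmetric, hence the
  condition that \<open>F\<close> is a graph.
\<close>
definition num_subgraphs :: "'b pair_pre_digraph \<Rightarrow> 'a pair_pre_digraph \<Rightarrow> nat" where
  "num_subgraphs H G =
     card {F. pair_graph F \<and> subgraph (with_proj F) (with_proj G)
              \<and> digraph_iso (with_proj H) (with_proj F)}"

definition triangle_free :: "'a pair_pre_digraph \<Rightarrow> bool" where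
  "triangle_free G \<longleftrightarrow>
     \<not> (\<exists>u v w. (u, v) \<in> parcs G \<and> (v, w) \<in> parcs G \<and> (u, w) \<in> parcs G)"

definition complete_bipartite :: "nat \<Rightarrow> nat \<Rightarrow> (nat + nat) pair_pre_digraph" where
  "complete_bipartite p q =
     \<lparr> pverts = Inl ` {..<p} \<union> Inr ` {..<q},
       parcs = Inl ` {..<p} \<times> Inr ` {..<q} \<union> Inr ` {..<q} \<times> Inl ` {..<p} \<rparr>"

abbreviation star :: "nat \<Rightarrow> (nat + nat) pair_pre_digraph" where
  "star a \<equiv> complete_bipartite 1 a"

abbreviation star_center :: "nat + nat" where
  "star_center \<equiv> Inl 0"

definition double_star :: "nat \<Rightarrow> nat \<Rightarrow> ((nat + nat) + (nat + nat)) pair_pre_digraph" where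
  "double_star a b =
     \<lparr> pverts = Inl ` pverts (star a) \<union> Inr ` pverts (star b),
       parcs = map_prod Inl Inl ` parcs (star a) \<union> map_prod Inr Inr ` parcs (star b)
               \<union> {(Inl star_center, Inr star_center), (Inr star_center, Inl star_center)} \<rparr>"

lemma complete_bipartite_digraph_complete_bipartite:
  "complete_bipartite_digraph p q (with_proj (complete_bipartite p q))"
  unfolding complete_bipartite_digraph_pair_def
proof (intro conjI exI)
  show "pverts (complete_bipartite p q) = Inl ` {..<p} \<union> Inr ` {..<q}"
    and "parcs (complete_bipartite p q) =
         Inl ` {..<p} \<times> Inr ` {..<q} \<union> Inr ` {..<q} \<times> Inl ` {..<p}"
    by (simp_all add: complete_bipartite_def)
  show "finite (pverts (complete_bipartite p q))"
    by (simp add: complete_bipartite_def)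
qed (auto simp: card_image)

lemma pair_graph_complete_bipartite: "pair_graph (complete_bipartite p q)"
  by (rule pair_graphI_complete_bipartite[OF complete_bipartite_digraph_complete_bipartite])

lemma triangle_free_complete_bipartite: "triangle_free (complete_bipartite p q)"
  by (auto simp: triangle_free_def complete_bipartite_def)

lemma pair_graph_double_star: "pair_graph (double_star a b)"
  by unfold_locales
     (auto simp: double_star_def complete_bipartite_def symmetric_def sym_def)

end

theory Submission
  imports Defs
begin

text \<open>
  A copy of \<open>S\<^bsub>a,a\<^esub>\<close> in \<open>G\<close> consists of a central edge \<open>uv\<close>, of \<open>a\<close> neighbours of \<open>u\<close> other than \<open>v\<close>
  and of \<open>a\<close> neighbours of \<open>v\<close> other than \<open>u\<close>. Hence \<open>G\<close> has at most
  \<open>\<Sum> (d(u) - 1 choose a) (d(v) - 1 choose a)\<close> copies, where the sum ranges over the edges \<open>uv\<close>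
  (\<open>num_double_stars_le\<close>).

  In a triangle-free graph both the number of terms and the size of each term are largest for the
  balanced complete bipartite graph. Adjacent vertices have no common neighbour, so
  \<open>d(u) + d(v) \<le> n\<close>, and since \<open>k \<mapsto> (k choose a)\<close> is log-concave, the product of the two binomial
  coefficients is largest when the two degrees are as equal as possible (\<open>choose_prod_le_balanced\<close>).
  By Mantel's theorem there are at most \<open>\<lfloor>n/2\<rfloor> \<lceil>n/2\<rceil>\<close> edges (\<open>card_arcs_le_Mantel\<close>).

  The balanced complete bipartite graph reaches the resulting bound, because there the two sets of
  leaves lie on different sides and are therefore automatically disjoint, and because a copy
  determines its central edge as the edge between its two vertices of degree \<open>a + 1 \<ge> 2\<close>
  (\<open>num_double_stars_complete_bipartite_ge\<close>).
\<close>

section \<open>Balanced products of binomial coefficients\<close>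

text \<open>
  Log-concavity of \<open>k \<mapsto> (k choose a)\<close>: for \<open>k \<ge> a\<close> the ratio of the values at \<open>k + 1\<close> and \<open>k\<close> is
  \<open>(k + 1) / (k + 1 - a)\<close>, which does not increase with \<open>k\<close>.
\<close>

lemma choose_log_concave:
  fixes x y :: nat
  assumes "x \<le> y"
  shows "(x choose a) * (Suc y choose a) \<le> (Suc x choose a) * (y choose a)"
proof (cases "x < a")
  case True
  then show ?thesis by (simp add: binomial_eq_0)
next
  case False
  have step: "(Suc k - a) * (Suc k choose a) = Suc k * (k choose a)" for k
    using binomial_absorb_comp[of "Suc k" a] by simp
  have "((Suc x - a) * (Suc y - a)) * ((x choose a) * (Suc y choose a))
      = (Suc x - a) * (x choose a) * ((Suc y - a) * (Suc y choose a))"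
    by simp
  also have "\<dots> = (Suc x - a) * Suc y * ((x choose a) * (y choose a))"
    unfolding step by (simp only: mult_ac)
  also have "\<dots> \<le> (Suc y - a) * Suc x * ((x choose a) * (y choose a))"
  proof (rule mult_right_mono)
    obtain k l where "x = a + k" "y = x + l"
      using False assms by (metis le_add_diff_inverse not_less)
    then show "(Suc x - a) * Suc y \<le> (Suc y - a) * Suc x"
      by (simp add: Suc_diff_le algebra_simps)
  qed simp
  also have "\<dots> = (Suc y - a) * (y choose a) * (Suc x * (x choose a))"
    by (simp only: mult_ac)
  also have "\<dots> = ((Suc x - a) * (Suc y - a)) * ((Suc x choose a) * (y choose a))"
    unfolding step[symmetric] by (simp only: mult_ac)
  finally show ?thesis
    using False assms by (subst (asm) mult_le_cancel1) auto
qed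

text \<open>
  While the two arguments differ by at least two, moving one unit from the larger to the smaller
  does not decrease the product, by log-concavity. Once they differ by at most one, they are bounded
  by \<open>p\<close> and \<open>q\<close>.
\<close>

lemma choose_prod_le_balanced:
  fixes x y p q :: nat
  assumes "x + y \<le> p + q" "p \<le> q" "q \<le> Suc p"
  shows "(x choose a) * (y choose a) \<le> (p choose a) * (q choose a)"
proof -
  have ordered: "(x choose a) * (y choose a) \<le> (p choose a) * (q choose a)"
    if "x \<le> y" "x + y \<le> p + q" for x y
    using that
  proof (induction "y - x" arbitrary: x y rule: less_induct)
    case less
    show ?case
    proof (cases "y \<le> Suc x")
      case True
      with less.prems assms have "x \<le> p" "y \<le> q" by linarith+
      then show ?thesis by (intro mult_mono binomial_right_mono) auto
    next
      case False
      then obtain z where z: "y = Suc z" "x < z" by (cases y) auto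
      have "(x choose a) * (y choose a) \<le> (Suc x choose a) * (z choose a)"
        using choose_log_concave[of x z a] z by simp
      also have "\<dots> \<le> (p choose a) * (q choose a)"
        using less.hyps[of z "Suc x"] less.prems z by simp
      finally show ?thesis .
    qed
  qed
  show ?thesis
    using ordered[of x y] ordered[of y x] assms(1) by (cases "x \<le> y") (simp_all add: ac_simps)
qed

section \<open>Degrees in triangle-free graphs\<close>

abbreviation nbrs :: "'a pair_pre_digraph \<Rightarrow> 'a \<Rightarrow> 'a set" where
  "nbrs G v \<equiv> parcs G `` {v}"

lemma (in pair_graph) nbrs_subset: "nbrs G v \<subseteq> pverts G"
  by (auto dest: in_arcsD2)

lemma (in pair_graph) finite_nbrs: "finite (nbrs G v)"
  using nbrs_subset pair_finite_verts by (rule finite_subset)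

lemma (in pair_graph) degree_sum_le_if_triangle_free:
  assumes "triangle_free G" "(u, v) \<in> parcs G"
  shows "card (nbrs G u) + card (nbrs G v) \<le> card (pverts G)"
proof -
  have "nbrs G u \<inter> nbrs G v = {}"
    using assms by (auto simp: triangle_free_def)
  then have "card (nbrs G u) + card (nbrs G v) = card (nbrs G u \<union> nbrs G v)"
    by (simp add: card_Un_disjoint finite_nbrs)
  also have "\<dots> \<le> card (pverts G)"
    using nbrs_subset by (intro card_mono) (auto simp: pair_finite_verts)
  finally show ?thesis .
qed

text \<open>
  Mantel's theorem. The neighbourhood of a vertex of maximum degree \<open>D\<close> is independent, so each edge
  meets one of the other \<open>n - D\<close> vertices. Each of these lies on at most \<open>D\<close> edges, so there are at
  most \<open>(n - D) D \<le> p q\<close> edges. The factor \<open>2\<close> appears because an edge is a pair of arcs.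
\<close>

lemma (in pair_graph) card_arcs_le_Mantel:
  assumes "triangle_free G" "card (pverts G) = p + q" "p \<le> q" "q \<le> Suc p"
  shows "card (parcs G) \<le> 2 * (p * q)"
proof (cases "pverts G = {}")
  case True
  then have "parcs G = {}" by (auto dest: in_arcsD1)
  then show ?thesis by simp
next
  case False
  define D where "D = Max ((\<lambda>v. card (nbrs G v)) ` pverts G)"
  have "D \<in> (\<lambda>v. card (nbrs G v)) ` pverts G"
    unfolding D_def using False pair_finite_verts by (intro Max_in) auto
  then obtain v where v: "v \<in> pverts G" "card (nbrs G v) = D" by auto
  have deg_le: "card (nbrs G x) \<le> D" if "x \<in> pverts G" for x
    unfolding D_def using that pair_finite_verts by (intro Max_ge) auto
  define X where "X = pverts G - nbrs G v"
  have cardX: "card X = p + q - D"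
    using v nbrs_subset assms(2) by (simp add: X_def card_Diff_subset finite_nbrs)
  have "parcs G \<subseteq> (\<Union>x\<in>X. {x} \<times> nbrs G x \<union> nbrs G x \<times> {x})"
  proof (rule subrelI)
    fix x y assume xy: "(x, y) \<in> parcs G"
    then have "x \<in> X \<or> y \<in> X"
      using assms(1) in_arcsD1[OF xy] in_arcsD2[OF xy]
      by (auto simp: X_def triangle_free_def)
    then show "(x, y) \<in> (\<Union>x\<in>X. {x} \<times> nbrs G x \<union> nbrs G x \<times> {x})"
      using xy arcs_symmetric[OF xy] by auto
  qed
  moreover have "finite X" by (simp add: X_def pair_finite_verts)
  ultimately have "card (parcs G) \<le> card (\<Union>x\<in>X. {x} \<times> nbrs G x \<union> nbrs G x \<times> {x})"
    by (intro card_mono) (auto intro: finite_nbrs)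
  also have "\<dots> \<le> (\<Sum>x\<in>X. card ({x} \<times> nbrs G x \<union> nbrs G x \<times> {x}))"
    using \<open>finite X\<close> by (rule card_UN_le)
  also have "\<dots> \<le> (\<Sum>x\<in>X. 2 * D)"
  proof (rule sum_mono)
    fix x assume "x \<in> X"
    then have "card (nbrs G x) \<le> D" using deg_le by (simp add: X_def)
    then show "card ({x} \<times> nbrs G x \<union> nbrs G x \<times> {x}) \<le> 2 * D"
      using card_Un_le[of "{x} \<times> nbrs G x" "nbrs G x \<times> {x}"]
      by (simp add: card_cartesian_product)
  qed
  also have "\<dots> = 2 * ((p + q - D) * D)"
    by (simp add: cardX)
  also have "(p + q - D) * D \<le> p * q"
  proof -
    have "D \<le> p + q"
      using v(2) assms(2) card_mono[OF pair_finite_verts nbrs_subset[of v]] by simp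
    \<comment> \<open>Since \<open>k choose 1 = k\<close>, this is another case of balancing two binomial coefficients.\<close>
    then show ?thesis
      using choose_prod_le_balanced[of "p + q - D" D p q 1] assms(3,4) by simp
  qed
  finally show ?thesis by simp
qed

section \<open>Copies of the double star\<close>

text \<open>
  When arcs are pairs of vertices, head and tail are the projections on both sides, so the map on
  the vertices determines the map on the arcs.
\<close>

lemma digraph_iso_with_proj_iff:
  "digraph_iso (with_proj H) (with_proj F) \<longleftrightarrow>
     pair_wf_digraph H \<and>
     (\<exists>h. inj_on h (pverts H) \<and> pverts F = h ` pverts H \<and> parcs F = map_prod h h ` parcs H)"
  (is "?L \<longleftrightarrow> ?R")
proof
  assume ?L
  then obtain f where f: "pre_digraph.digraph_isomorphism (with_proj H) f"
    and eq: "with_proj F = app_iso f (with_proj H)"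
    unfolding digraph_iso_def by auto
  have "iso_tail f = fst" "iso_head f = snd"
    using arg_cong[OF eq, of tail] arg_cong[OF eq, of head] by simp_all
  with f have "iso_arcs f e = map_prod (iso_verts f) (iso_verts f) e" if "e \<in> parcs H" for e
    using that by (cases e) (auto simp: pre_digraph.digraph_isomorphism_def prod_eq_iff)
  then have "iso_arcs f ` parcs H = map_prod (iso_verts f) (iso_verts f) ` parcs H"
    by (intro image_cong) auto
  with f show ?R
    using arg_cong[OF eq, of verts] arg_cong[OF eq, of arcs]
    by (auto simp: pre_digraph.digraph_isomorphism_def wf_digraph_wp_iff intro!: exI[of _ "iso_verts f"])
next
  assume ?R
  then obtain h where wf: "pair_wf_digraph H" and inj: "inj_on h (pverts H)"
    and F: "pverts F = h ` pverts H" "parcs F = map_prod h h ` parcs H" by auto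
  define f where "f = \<lparr>iso_verts = h, iso_arcs = map_prod h h, iso_head = snd, iso_tail = fst\<rparr>"
  have "parcs H \<subseteq> pverts H \<times> pverts H"
    using pair_wf_digraph.wellformed'[OF wf] by auto
  then have "inj_on (map_prod h h) (parcs H)"
    using map_prod_inj_on[OF inj inj] by (rule inj_on_subset[rotated])
  then have "pre_digraph.digraph_isomorphism (with_proj H) f"
    using wf inj by (simp add: f_def pre_digraph.digraph_isomorphism_def wf_digraph_wp_iff)
  moreover have "with_proj F = app_iso f (with_proj H)"
    using F by (simp add: f_def with_proj_def app_iso_def)
  ultimately show ?L unfolding digraph_iso_def by blast
qed

definition double_star_at :: "'a \<Rightarrow> 'a \<Rightarrow> 'a set \<Rightarrow> 'a set \<Rightarrow> 'a pair_pre_digraph" where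
  "double_star_at u v A B =
     \<lparr> pverts = {u, v} \<union> A \<union> B,
       parcs = {u} \<times> insert v A \<union> insert v A \<times> {u} \<union> {v} \<times> insert u B \<union> insert u B \<times> {v} \<rparr>"

lemma double_star_eq_double_star_at:
  "double_star a b = double_star_at (Inl (Inl 0)) (Inr (Inl 0)) (Inl ` Inr ` {..<a}) (Inr ` Inr ` {..<b})"
proof -
  have "map_prod f f ` (X \<times> Y) = f ` X \<times> f ` Y" for f :: "nat + nat \<Rightarrow> (nat + nat) + (nat + nat)" and X Y
    by (rule map_prod_surj_on) simp_all
  then show ?thesis
    by (auto simp: double_star_def double_star_at_def complete_bipartite_def image_Un lessThan_Suc)
qed

lemma image_double_star_at:
  "\<lparr>pverts = h ` pverts (double_star_at u v A B), parcs = map_prod h h ` parcs (double_star_at u v A B)\<rparr> =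
     double_star_at (h u) (h v) (h ` A) (h ` B)"
proof -
  have "map_prod h h ` (X \<times> Y) = h ` X \<times> h ` Y" for X Y
    by (rule map_prod_surj_on) simp_all
  then show ?thesis by (simp add: double_star_at_def image_Un)
qed

lemma pverts_double_star_at: "pverts (double_star_at u v A B) = {u, v} \<union> A \<union> B"
  by (simp add: double_star_at_def)

text \<open>
  Copies can thus be handled through their centres and leaf sets instead of isomorphisms.
\<close>

lemma double_star_iso_iff:
  "digraph_iso (with_proj (double_star a b)) (with_proj F) \<longleftrightarrow>
     (\<exists>u v A B. F = double_star_at u v A B \<and> finite A \<and> card A = a \<and> finite B \<and> card B = b
        \<and> u \<noteq> v \<and> {u, v} \<inter> (A \<union> B) = {} \<and> A \<inter> B = {})"
  (is "?L \<longleftrightarrow> ?R")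
proof
  assume ?L
  then obtain h where inj: "inj_on h (pverts (double_star a b))"
    and F: "pverts F = h ` pverts (double_star a b)" "parcs F = map_prod h h ` parcs (double_star a b)"
    unfolding digraph_iso_with_proj_iff by blast
  define u0 v0 A0 B0 where "u0 = (Inl (Inl 0) :: (nat + nat) + (nat + nat))"
    and "v0 = (Inr (Inl 0) :: (nat + nat) + (nat + nat))"
    and "A0 = (Inl ` Inr ` {..<a} :: ((nat + nat) + (nat + nat)) set)"
    and "B0 = (Inr ` Inr ` {..<b} :: ((nat + nat) + (nat + nat)) set)"
  note abs = u0_def v0_def A0_def B0_def
  have S: "double_star a b = double_star_at u0 v0 A0 B0"
    by (simp only: abs double_star_eq_double_star_at)
  have "finite A0" "card A0 = a" "finite B0" "card B0 = b"
    by (simp_all add: abs card_image)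
  moreover have "u0 \<noteq> v0" "{u0, v0} \<inter> (A0 \<union> B0) = {}" "A0 \<inter> B0 = {}"
    by (auto simp: abs)
  moreover have inj': "inj_on h ({u0, v0} \<union> A0 \<union> B0)"
    using inj by (simp add: S pverts_double_star_at)
  moreover have "inj_on h A0" "inj_on h B0"
    using inj' by (auto elim: inj_on_subset)
  ultimately have "card (h ` A0) = a" "card (h ` B0) = b" "finite (h ` A0)" "finite (h ` B0)"
    "h u0 \<noteq> h v0" "{h u0, h v0} \<inter> (h ` A0 \<union> h ` B0) = {}" "h ` A0 \<inter> h ` B0 = {}"
    by (simp_all add: card_image) (blast dest: inj_onD)+
  moreover have "F = double_star_at (h u0) (h v0) (h ` A0) (h ` B0)"
    using F by (simp add: S image_double_star_at[symmetric])
  ultimately show ?R by blast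
next
  assume ?R
  then obtain u v A B where F: "F = double_star_at u v A B"
    and AB: "finite A" "card A = a" "finite B" "card B = b"
    and disj: "u \<noteq> v" "{u, v} \<inter> (A \<union> B) = {}" "A \<inter> B = {}"
    by blast
  obtain f g where f: "bij_betw f {..<a} A" and g: "bij_betw g {..<b} B"
    using AB ex_bij_betw_nat_finite[of A] ex_bij_betw_nat_finite[of B]
    by (auto simp: atLeast0LessThan)
  define h where "h x = (case x of Inl (Inl _) \<Rightarrow> u | Inl (Inr i) \<Rightarrow> f i
    | Inr (Inl _) \<Rightarrow> v | Inr (Inr j) \<Rightarrow> g j)" for x :: "(nat + nat) + (nat + nat)"
  have "h ` Inl ` Inr ` {..<a} = A" "h ` Inr ` Inr ` {..<b} = B"
    using f g by (simp_all add: h_def image_image bij_betw_def)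
  then have "\<lparr>pverts = h ` pverts (double_star a b), parcs = map_prod h h ` parcs (double_star a b)\<rparr> = F"
    unfolding double_star_eq_double_star_at image_double_star_at by (simp add: F h_def)
  moreover
  have fg: "f i \<noteq> g j" if "i < a" "j < b" for i j
  proof -
    have "f i \<in> A" "g j \<in> B" using that f g by (simp_all add: bij_betw_apply)
    then show ?thesis using disj(3) by auto
  qed
  have "inj_on h (pverts (double_star a b))"
    using disj(1,2) fg fg[symmetric] bij_betw_imp_inj_on[OF f] bij_betw_imp_inj_on[OF g]
      bij_betwE[OF f] bij_betwE[OF g]
    by (auto simp: double_star_eq_double_star_at pverts_double_star_at h_def inj_on_def)
  moreover have "pair_wf_digraph (double_star a b)"
    by (rule pair_digraph.pair_wf_digraph[OF pair_graph.axioms(1)[OF pair_graph_double_star]])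
  ultimately show ?L
    unfolding digraph_iso_with_proj_iff by (intro conjI exI[of _ h]) auto
qed

lemma double_star_at_commute: "double_star_at v u B A = double_star_at u v A B"
  by (auto simp: double_star_at_def)

section \<open>Counting the copies\<close>

text \<open>
  An oriented central edge with a set of \<open>a\<close> leaves at each end. The two sets are chosen independently,
  which makes the number of choices a product; if they overlap, the frame does not describe a copy.
\<close>

definition double_star_frames ::
    "'a pair_pre_digraph \<Rightarrow> nat \<Rightarrow> (('a \<times> 'a) \<times> 'a set \<times> 'a set) set" where
  "double_star_frames G a = (SIGMA e : parcs G.
     {A. A \<subseteq> nbrs G (fst e) - {snd e} \<and> card A = a} \<times> {B. B \<subseteq> nbrs G (snd e) - {fst e} \<and> card B = a})"

lemma finite_sized_subsets: "finite X \<Longrightarrow> finite {A. A \<subseteq> X \<and> card A = a}"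
  by (rule finite_subset[of _ "Pow X"]) auto

lemma (in pair_graph) finite_double_star_frames: "finite (double_star_frames G a)"
proof -
  show ?thesis
    unfolding double_star_frames_def
    by (intro finite_SigmaI finite_cartesian_product finite_sized_subsets pair_finite_arcs)
      (simp_all add: finite_nbrs)
qed

lemma (in pair_graph) card_double_star_frames:
  "card (double_star_frames G a) =
     (\<Sum>(u, v)\<in>parcs G. ((card (nbrs G u) - 1) choose a) * ((card (nbrs G v) - 1) choose a))"
proof -
  have card: "card {A. A \<subseteq> nbrs G x - {y} \<and> card A = a} = (card (nbrs G x) - 1) choose a"
    if "(x, y) \<in> parcs G" for x y
    using that n_subsets[of "nbrs G x - {y}" a] by (simp add: finite_nbrs)
  show ?thesis
    unfolding double_star_frames_def
    by (subst card_SigmaI)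
      (auto simp: pair_finite_arcs finite_sized_subsets finite_nbrs card card_cartesian_product arcs_symmetric intro!: sum.cong)
qed

text \<open>
  The factor \<open>2\<close> is there because both orientations of the central edge of a copy give a frame of
  that copy. It cancels against the two arcs of each edge in the sum over all arcs.
\<close>

lemma (in pair_graph) num_double_stars_le:
  "2 * num_subgraphs (double_star a a) G \<le> card (double_star_frames G a)"
proof -
  define copies where "copies = {F. pair_graph F \<and> subgraph (with_proj F) (with_proj G)
              \<and> digraph_iso (with_proj (double_star a a)) (with_proj F)}"
  let ?build = "\<lambda>((u, v), A, B). double_star_at u v A B"
  let ?swap = "\<lambda>((u, v), A, B). ((v, u), B, A)"
  have "\<exists>t. t \<in> double_star_frames G a \<and> ?build t = F" if "F \<in> copies" for F
  proof -
    from that have sub: "parcs F \<subseteq> parcs G"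
      and iso: "digraph_iso (with_proj (double_star a a)) (with_proj F)"
      by (simp_all add: copies_def subgraph_def)
    from iso obtain u v A B where F: "F = double_star_at u v A B" and AB: "card A = a" "card B = a"
      and disj: "u \<noteq> v" "{u, v} \<inter> (A \<union> B) = {}"
      unfolding double_star_iso_iff by blast
    have "{u} \<times> insert v A \<union> {v} \<times> insert u B \<subseteq> parcs F"
      by (auto simp: F double_star_at_def)
    then have "{u} \<times> insert v A \<union> {v} \<times> insert u B \<subseteq> parcs G" using sub by (rule subset_trans)
    with AB disj have "((u, v), A, B) \<in> double_star_frames G a"
      by (auto simp: double_star_frames_def)
    then show ?thesis using F by (intro exI[of _ "((u, v), A, B)"]) simp
  qed
  then have "\<forall>F\<in>copies. \<exists>t. t \<in> double_star_frames G a \<and> ?build t = F" by blast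
  from bchoice[OF this] obtain frame where
    "\<forall>F\<in>copies. frame F \<in> double_star_frames G a \<and> ?build (frame F) = F" ..
  then have frame: "frame F \<in> double_star_frames G a" "?build (frame F) = F" if "F \<in> copies" for F
    using that by blast+
  have swap: "?swap t \<in> double_star_frames G a" "?swap t \<noteq> t" "?build (?swap t) = ?build t"
    if "t \<in> double_star_frames G a" for t
    using that
    by (auto simp: double_star_frames_def double_star_at_commute arcs_symmetric dest: no_loops')
  define orient where "orient F b = (if b then frame F else ?swap (frame F))" for F b
  have orient: "orient F b \<in> double_star_frames G a" "?build (orient F b) = F" if "F \<in> copies" for F b
    using frame[OF that] swap(1,3)[OF frame(1)[OF that]] by (cases b; simp add: orient_def)+
  have "inj_on (\<lambda>(F, b). orient F b) (copies \<times> UNIV)"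
  proof (rule inj_onI, clarify)
    fix F b F' b' assume F: "F \<in> copies" "F' \<in> copies" and eq: "orient F b = orient F' b'"
    have "F = F'"
      using orient(2)[OF F(1), of b] orient(2)[OF F(2), of b'] unfolding eq by (rule trans[OF sym])
    moreover have "b = b'"
      using eq swap(2)[OF frame(1)[OF F(2)]] unfolding \<open>F = F'\<close> orient_def
      by (cases b; cases b'; simp del: split_paired_All; metis)
    ultimately show "F = F' \<and> b = b'" ..
  qed
  moreover have "(\<lambda>(F, b). orient F b) ` (copies \<times> UNIV) \<subseteq> double_star_frames G a"
    by (auto intro: orient(1) simp del: split_paired_All)
  ultimately have "card (copies \<times> (UNIV :: bool set)) \<le> card (double_star_frames G a)"
    by (rule card_inj_on_le) (rule finite_double_star_frames)
  then show ?thesis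
    by (simp add: num_subgraphs_def copies_def card_cartesian_product)
qed

text \<open>
  Bounding a number of copies from below needs this: an infinite set of copies would have
  cardinality \<open>0\<close>.
\<close>

lemma finite_subgraphs:
  assumes "finite (pverts G)" "finite (parcs G)"
  shows "finite {F. pair_graph F \<and> subgraph (with_proj F) (with_proj G) \<and> P F}"
proof (rule finite_subset)
  show "{F. pair_graph F \<and> subgraph (with_proj F) (with_proj G) \<and> P F}
    \<subseteq> (\<lambda>(V, E). \<lparr>pverts = V, parcs = E\<rparr>) ` (Pow (pverts G) \<times> Pow (parcs G))"
  proof
    fix F assume "F \<in> {F. pair_graph F \<and> subgraph (with_proj F) (with_proj G) \<and> P F}"
    then have "(pverts F, parcs F) \<in> Pow (pverts G) \<times> Pow (parcs G)"
      by (auto simp: subgraph_def)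
    moreover have "F = (\<lambda>(V, E). \<lparr>pverts = V, parcs = E\<rparr>) (pverts F, parcs F)" by simp
    ultimately show "F \<in> (\<lambda>(V, E). \<lparr>pverts = V, parcs = E\<rparr>) ` (Pow (pverts G) \<times> Pow (parcs G))"
      by (rule rev_image_eqI)
  qed
qed (use assms in auto)

lemma pair_graph_double_star_at:
  assumes "finite A" "finite B" "u \<noteq> v" "u \<notin> A" "v \<notin> B"
  shows "pair_graph (double_star_at u v A B)"
  using assms
  by unfold_locales (auto simp: double_star_at_def symmetric_def sym_def)

text \<open>
  It suffices to consider frames whose central edge is oriented from the left to the right side.
  Their leaf sets lie on different sides, so each choice of leaves gives a copy.
\<close>

lemma num_double_stars_complete_bipartite_ge:
  assumes "a \<ge> 1"
  shows "p * q * (((p - 1) choose a) * ((q - 1) choose a))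
    \<le> num_subgraphs (double_star a a) (complete_bipartite p q)"
proof -
  let ?K = "complete_bipartite p q"
  let ?copies = "{F. pair_graph F \<and> subgraph (with_proj F) (with_proj ?K)
              \<and> digraph_iso (with_proj (double_star a a)) (with_proj F)}"
  let ?subsets = "\<lambda>X. {A :: nat set. A \<subseteq> X \<and> card A = a}"
  let ?frames = "SIGMA (i, j) : {..<p} \<times> {..<q}. ?subsets ({..<p} - {i}) \<times> ?subsets ({..<q} - {j})"
  let ?build = "\<lambda>((i, j), B, A). double_star_at (Inl i :: nat + nat) (Inr j) (Inr ` A) (Inl ` B)"
  have "card ?frames = (\<Sum>(i, j)\<in>{..<p} \<times> {..<q}. ((p - 1) choose a) * ((q - 1) choose a))"
    by (subst card_SigmaI) (auto simp: finite_sized_subsets card_cartesian_product n_subsets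
        simp del: sum_constant intro!: sum.cong)
  also have "\<dots> = p * q * (((p - 1) choose a) * ((q - 1) choose a))"
    by (simp add: card_cartesian_product split_def)
  finally have card: "card ?frames = \<dots>" .
  have "inj_on ?build ?frames"
  proof (rule inj_onI)
    fix s t assume st: "s \<in> ?frames" "t \<in> ?frames" "?build s = ?build t"
    obtain i j A B where s: "s = ((i, j), B, A)" by (metis prod.exhaust)
    obtain i' j' A' B' where t: "t = ((i', j'), B', A')" by (metis prod.exhaust)
    have ne: "A \<noteq> {}" "B \<noteq> {}" "A' \<noteq> {}" "B' \<noteq> {}" "j \<notin> A" "i \<notin> B" "j' \<notin> A'" "i' \<notin> B'"
      using st(1,2) assms by (auto simp: s t)
    have arcs: "k = i \<and> l \<in> insert j A \<or> l = j \<and> k \<in> insert i B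
        \<longleftrightarrow> k = i' \<and> l \<in> insert j' A' \<or> l = j' \<and> k \<in> insert i' B'" for k l
    proof -
      have "(Inl k, Inr l) \<in> parcs (?build s) \<longleftrightarrow> (Inl k, Inr l) \<in> parcs (?build t)"
        using st(3) by simp
      then show ?thesis by (auto simp: s t double_star_at_def)
    qed
    \<comment> \<open>As \<open>A\<close> and \<open>B\<close> are nonempty, \<open>i\<close> and \<open>j\<close> are the only vertices of degree at least two on their
      sides. Each leaf has a single neighbour.\<close>
    obtain k l where kl: "k \<in> B" "l \<in> A" using ne by blast
    have "i = i'" using arcs[of i j] arcs[of i l] kl ne by auto
    moreover have "j = j'" using arcs[of i j] arcs[of k j] kl ne by auto
    moreover have "x \<in> A \<longleftrightarrow> x \<in> A'" "x \<in> B \<longleftrightarrow> x \<in> B'" for x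
      using arcs[of i x] arcs[of x j] ne calculation by auto
    then have "A = A'" "B = B'" by blast+
    ultimately show "s = t" by (simp add: s t)
  qed
  moreover have "?build ` ?frames \<subseteq> ?copies"
  proof (rule image_subsetI)
    fix t assume "t \<in> ?frames"
    then obtain i j A B where t: "t = ((i, j), B, A)" and ij: "i < p" "j < q"
      and A: "A \<subseteq> {..<q} - {j}" "card A = a" and B: "B \<subseteq> {..<p} - {i}" "card B = a"
      by auto
    let ?F = "double_star_at (Inl i :: nat + nat) (Inr j) (Inr ` A) (Inl ` B)"
    have finAB: "finite A" "finite B" using A B by (auto intro: finite_subset)
    have F: "pair_graph ?F"
      using A B finAB by (intro pair_graph_double_star_at) auto
    moreover have "subgraph (with_proj ?F) (with_proj ?K)"
      unfolding subgraph_def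
      using ij A(1) B(1) F pair_graph_complete_bipartite[of p q]
      by (auto simp: double_star_at_def complete_bipartite_def wf_digraph_wp_iff
          intro: pair_digraph.pair_wf_digraph pair_graph.axioms(1))
    moreover have "digraph_iso (with_proj (double_star a a)) (with_proj ?F)"
      unfolding double_star_iso_iff
      using A B finAB
      by (intro exI[of _ "Inl i"] exI[of _ "Inr j"] exI[of _ "Inr ` A"] exI[of _ "Inl ` B"])
        (auto simp: card_image)
    ultimately show "?build t \<in> ?copies" by (simp add: t)
  qed
  moreover have "finite ?copies"
    by (rule finite_subgraphs) (auto simp: complete_bipartite_def)
  ultimately have "card ?frames \<le> card ?copies" by (rule card_inj_on_le)
  then show ?thesis by (simp only: card num_subgraphs_def)
qed

section \<open>The extremal graph\<close>

theorem theorem3: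
  fixes a n :: nat and G :: "'a pair_pre_digraph"
  assumes "a \<ge> 1" and "n \<ge> 1"
    and "pair_graph G" and "card (pverts G) = n" and "triangle_free G"
  shows "num_subgraphs (double_star a a) G
         \<le> num_subgraphs (double_star a a) (complete_bipartite (n div 2) ((n + 1) div 2))"
proof -
  interpret pair_graph G by fact
  define p q where "p = n div 2" and "q = (n + 1) div 2"
  define M where "M = ((p - 1) choose a) * ((q - 1) choose a)"
  have pq: "card (pverts G) = p + q" "p \<le> q" "q \<le> Suc p"
    using assms(4) by (auto simp: p_def q_def)
  have "2 * num_subgraphs (double_star a a) G \<le> card (double_star_frames G a)"
    by (rule num_double_stars_le)
  also have "\<dots> = (\<Sum>(u, v)\<in>parcs G.
      ((card (nbrs G u) - 1) choose a) * ((card (nbrs G v) - 1) choose a))"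
    by (rule card_double_star_frames)
  also have "\<dots> \<le> (\<Sum>e\<in>parcs G. M)"
  proof (rule sum_mono, clarify)
    fix u v assume uv: "(u, v) \<in> parcs G"
    \<comment> \<open>Both degrees are positive, and so are \<open>p\<close> and \<open>q\<close>; hence no subtraction of \<open>1\<close> truncates.\<close>
    have "nbrs G u \<noteq> {}" "nbrs G v \<noteq> {}" using uv arcs_symmetric[OF uv] by auto
    then have "card (nbrs G u) \<ge> 1" "card (nbrs G v) \<ge> 1"
      by (simp_all add: Suc_le_eq card_gt_0_iff finite_nbrs)
    then have "(card (nbrs G u) - 1) + (card (nbrs G v) - 1) \<le> (p - 1) + (q - 1)"
      using degree_sum_le_if_triangle_free[OF assms(5) uv] pq by linarith
    then show "((card (nbrs G u) - 1) choose a) * ((card (nbrs G v) - 1) choose a) \<le> M"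
      unfolding M_def using pq by (intro choose_prod_le_balanced) auto
  qed
  also have "\<dots> = card (parcs G) * M" by simp
  also have "\<dots> \<le> 2 * (p * q) * M"
    using card_arcs_le_Mantel[OF assms(5) pq] by (rule mult_right_mono) simp
  also have "\<dots> \<le> 2 * num_subgraphs (double_star a a) (complete_bipartite p q)"
    using num_double_stars_complete_bipartite_ge[OF assms(1), of p q] by (simp add: M_def mult.assoc)
  finally show ?thesis by (simp add: p_def q_def)
qed

end
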